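(* The underlying undirected graph of any 2-qBMG is $C_6$-free, i.e. it has no induced subgraph isomorphic to the cycle graph $C_6$ on six vertices.
   Context: A two-color quasi best match graph (2-qBMG) is a bipartite directed graph $\overrightarrow{G}$ (vertex set split into two color classes, every edge joining vertices of different colors) without loops and parallel edges, satisfying: (N1) if $u$ and $v$ are two independent (non-adjacent) vertices then there exist no vertices $w,t$ such that $ut, vw, tw$ are edges; (N2) if $uv, vw, wt$ are edges then $ut$ is an edge; (N3) if $u$ and $v$ have a common out-neighbor then either every out-neighbor of $u$ is an out-neighbor of $v$ or every out-neighbor of $v$ is an out-neighbor of $u$. The underlying undirected graph of a digraph has the same vertex set and an undirected edge $\{u,v\}$ whenever $uv$ or $vu$ is a directed edge. The cycle graph $C_6$ has vertices $v_1,\dots,v_6$ and exactly the edges $v_iv_{i+1}$ ($1\le i\le5$) and $v_6v_1$. *)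

theory Defs
  imports "Graph_Theory.Graph_Theory"
begin

text \<open>
  Parallel arcs are two arcs with the same tail and the same head, so a pair of opposite arcs
  \<open>uv\<close> and \<open>vu\<close> is allowed. The vertex set is not required to be finite.
\<close>

locale two_qBMG = loopfree_digraph G + nomulti_digraph G
  for G :: "('a, 'b) pre_digraph" +
  assumes bipartite:
    "\<exists>A B. verts G = A \<union> B \<and> A \<inter> B = {} \<and>
       (\<forall>u v. u \<rightarrow>\<^bsub>G\<^esub> v \<longrightarrow> (u \<in> A \<and> v \<in> B) \<or> (u \<in> B \<and> v \<in> A))"
  and N1: "\<lbrakk>u \<in> verts G; v \<in> verts G; u \<noteq> v; \<not> u \<rightarrow>\<^bsub>G\<^esub> v; \<not> v \<rightarrow>\<^bsub>G\<^esub> u\<rbrakk>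
       \<Longrightarrow> \<not> (\<exists>w t. u \<rightarrow>\<^bsub>G\<^esub> t \<and> v \<rightarrow>\<^bsub>G\<^esub> w \<and> t \<rightarrow>\<^bsub>G\<^esub> w)"
  and N2: "\<lbrakk>u \<rightarrow>\<^bsub>G\<^esub> v; v \<rightarrow>\<^bsub>G\<^esub> w; w \<rightarrow>\<^bsub>G\<^esub> t\<rbrakk> \<Longrightarrow> u \<rightarrow>\<^bsub>G\<^esub> t"
  and N3: "\<lbrakk>u \<in> verts G; v \<in> verts G; \<exists>w. u \<rightarrow>\<^bsub>G\<^esub> w \<and> v \<rightarrow>\<^bsub>G\<^esub> w\<rbrakk>
       \<Longrightarrow> (\<forall>w. u \<rightarrow>\<^bsub>G\<^esub> w \<longrightarrow> v \<rightarrow>\<^bsub>G\<^esub> w) \<or> (\<forall>w. v \<rightarrow>\<^bsub>G\<^esub> w \<longrightarrow> u \<rightarrow>\<^bsub>G\<^esub> w)"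

text \<open>
  As usual in the Graph Theory library, an undirected graph is a symmetric digraph, with an
  undirected edge \<open>{u, v}\<close> represented by the two arcs \<open>(u, v)\<close> and \<open>(v, u)\<close>.
\<close>

definition underlying_graph :: "('a, 'b) pre_digraph \<Rightarrow> ('a, 'a \<times> 'a) pre_digraph" where
  "underlying_graph G = with_proj (mk_symmetric G)"

definition C6 :: "(nat, nat \<times> nat) pre_digraph" where
  "C6 = with_proj \<lparr> pverts = {1..6},
     parcs = (\<Union>i\<in>{1..5}. {(i, i + 1), (i + 1, i)}) \<union> {(6, 1), (1, 6)} \<rparr>"

definition C6_free :: "('a, 'b) pre_digraph \<Rightarrow> bool" where
  "C6_free G \<longleftrightarrow> \<not> (\<exists>H. induced_subgraph H G \<and> digraph_iso H C6)"

end

theory Submission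
  imports Defs
begin

text \<open>
  Along an induced hexagon any path on four vertices has non-adjacent ends, so by N1 and N2 it
  contains no directed path of length two. Hence every vertex of the hexagon is either a source or
  a sink, and the two alternate. Two sources at distance two have a common out-neighbor, so N3
  makes one of them a tail of an arc to its antipodal vertex, which is a chord.
\<close>

lemma underlying_graph_adj:
  "u \<rightarrow>\<^bsub>underlying_graph G\<^esub> v \<longleftrightarrow> u \<rightarrow>\<^bsub>G\<^esub> v \<or> v \<rightarrow>\<^bsub>G\<^esub> u"
  by (force simp: underlying_graph_def parcs_mk_symmetric arcs_ends_conv)

lemma induced_subgraph_adj:
  assumes "induced_subgraph H G" "u \<in> verts H" "v \<in> verts H"
  shows "u \<rightarrow>\<^bsub>H\<^esub> v \<longleftrightarrow> u \<rightarrow>\<^bsub>G\<^esub> v"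
proof -
  have "tail H = tail G" "head H = head G"
    using assms(1) by (auto simp: induced_subgraph_def subgraph_def compatible_def)
  then show ?thesis
    using assms by (auto simp: induced_subgraph_def arcs_ends_conv image_iff)
qed

text \<open>Library isomorphisms act on vertices and on arcs. Being an induced cycle concerns
  adjacency alone, so only the vertex map is kept.\<close>

lemma digraph_isoE:
  assumes "digraph_iso G H"
  obtains f where "bij_betw f (verts G) (verts H)"
    "\<And>u v. \<lbrakk>u \<in> verts G; v \<in> verts G\<rbrakk> \<Longrightarrow> f u \<rightarrow>\<^bsub>H\<^esub> f v \<longleftrightarrow> u \<rightarrow>\<^bsub>G\<^esub> v"
proof -
  obtain h where h: "pre_digraph.digraph_isomorphism G h" and H: "H = app_iso h G"
    using assms by (auto simp: digraph_iso_def)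
  interpret wf_digraph G
    using h by (simp add: pre_digraph.digraph_isomorphism_def)
  have inj: "inj_on (iso_verts h) (verts G)"
    using h by (rule digraph_isomorphism_inj_on_verts)
  show thesis
  proof (rule that)
    show "bij_betw (iso_verts h) (verts G) (verts H)"
      using inj by (simp add: H inj_on_imp_bij_betw)
  next
    fix u v assume uv: "u \<in> verts G" "v \<in> verts G"
    show "iso_verts h u \<rightarrow>\<^bsub>H\<^esub> iso_verts h v \<longleftrightarrow> u \<rightarrow>\<^bsub>G\<^esub> v"
    proof
      assume "iso_verts h u \<rightarrow>\<^bsub>H\<^esub> iso_verts h v"
      then obtain x y where xy: "x \<rightarrow>\<^bsub>G\<^esub> y"
        "iso_verts h x = iso_verts h u" "iso_verts h y = iso_verts h v"
        by (auto simp: H arcs_ends_app_iso_eq[OF h])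
      \<comment> \<open>Injectivity applies since well-formedness puts the ends of the preimage arc
        into \<open>verts G\<close>.\<close>
      then have "x = u" "y = v"
        using uv adj_in_verts[OF xy(1)] inj_onD[OF inj] by blast+
      then show "u \<rightarrow>\<^bsub>G\<^esub> v"
        using xy by simp
    next
      assume "u \<rightarrow>\<^bsub>G\<^esub> v"
      then show "iso_verts h u \<rightarrow>\<^bsub>H\<^esub> iso_verts h v"
        unfolding H arcs_ends_app_iso_eq[OF h] by (rule rev_image_eqI) simp
    qed
  qed
qed

context two_qBMG
begin

text \<open>Suppose \<open>a\<close>, \<open>b\<close>, \<open>c\<close> were a directed path. An
  arc from \<open>d\<close> to \<open>c\<close> would give the pattern that N1 forbids for the
  independent pair \<open>a\<close>, \<open>d\<close>; an arc from \<open>c\<close> to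
  \<open>d\<close> would let N2 produce the arc from \<open>a\<close> to \<open>d\<close>.\<close>

lemma no_directed_turn:
  assumes "c \<rightarrow>\<^bsub>G\<^esub> d \<or> d \<rightarrow>\<^bsub>G\<^esub> c" "a \<noteq> d" "\<not> a \<rightarrow>\<^bsub>G\<^esub> d" "\<not> d \<rightarrow>\<^bsub>G\<^esub> a" "a \<rightarrow>\<^bsub>G\<^esub> b"
  shows "\<not> b \<rightarrow>\<^bsub>G\<^esub> c"
proof
  assume "b \<rightarrow>\<^bsub>G\<^esub> c"
  have "\<not> d \<rightarrow>\<^bsub>G\<^esub> c"
    using N1[of a d] assms \<open>b \<rightarrow>\<^bsub>G\<^esub> c\<close> by (metis adj_in_verts)
  moreover have "\<not> c \<rightarrow>\<^bsub>G\<^esub> d"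
    using N2[of a b c d] assms \<open>b \<rightarrow>\<^bsub>G\<^esub> c\<close> by blast
  ultimately show False
    using assms by blast
qed

text \<open>Excludes one orientation of the side between \<open>p\<close> and \<open>q\<close>; a
  reflection of the hexagon will exclude the other.\<close>

lemma no_induced_hexagon_oriented:
  assumes cycle: "q \<rightarrow>\<^bsub>G\<^esub> r \<or> r \<rightarrow>\<^bsub>G\<^esub> q" "r \<rightarrow>\<^bsub>G\<^esub> s \<or> s \<rightarrow>\<^bsub>G\<^esub> r"
      "s \<rightarrow>\<^bsub>G\<^esub> t \<or> t \<rightarrow>\<^bsub>G\<^esub> s" "t \<rightarrow>\<^bsub>G\<^esub> u \<or> u \<rightarrow>\<^bsub>G\<^esub> t" "u \<rightarrow>\<^bsub>G\<^esub> p \<or> p \<rightarrow>\<^bsub>G\<^esub> u"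
    and distinct: "distinct [p, q, r, s, t, u]"
    and chordless: "\<not> p \<rightarrow>\<^bsub>G\<^esub> s" "\<not> s \<rightarrow>\<^bsub>G\<^esub> p" "\<not> q \<rightarrow>\<^bsub>G\<^esub> t" "\<not> t \<rightarrow>\<^bsub>G\<^esub> q" "\<not> r \<rightarrow>\<^bsub>G\<^esub> u" "\<not> u \<rightarrow>\<^bsub>G\<^esub> r"
  shows "\<not> q \<rightarrow>\<^bsub>G\<^esub> p"
proof
  assume "q \<rightarrow>\<^bsub>G\<^esub> p"
  \<comment> \<open>The instantiation order is \<open>c\<close>, \<open>d\<close>, \<open>a\<close>,
    \<open>b\<close>: an arc from \<open>r\<close> to \<open>q\<close> would make a directed turn on
    the path \<open>r\<close>, \<open>q\<close>, \<open>p\<close>, \<open>u\<close>. The next two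
    steps use \<open>q\<close>, \<open>r\<close>, \<open>s\<close>, \<open>t\<close> and then its
    reverse.\<close>
  have "q \<rightarrow>\<^bsub>G\<^esub> r"
    using no_directed_turn[of p u r q] cycle distinct chordless \<open>q \<rightarrow>\<^bsub>G\<^esub> p\<close> by auto
  have "s \<rightarrow>\<^bsub>G\<^esub> r"
    using no_directed_turn[of s t q r] cycle distinct chordless \<open>q \<rightarrow>\<^bsub>G\<^esub> r\<close> by auto
  have "s \<rightarrow>\<^bsub>G\<^esub> t"
    using no_directed_turn[of r q t s] cycle distinct chordless \<open>s \<rightarrow>\<^bsub>G\<^esub> r\<close> by auto
  \<comment> \<open>The common out-neighbor is \<open>r\<close>. Nested out-neighborhoods pass
    \<open>p\<close> from \<open>q\<close> to \<open>s\<close>, or \<open>t\<close> from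
    \<open>s\<close> to \<open>q\<close>; both arcs are long diagonals.\<close>
  have "s \<rightarrow>\<^bsub>G\<^esub> p \<or> q \<rightarrow>\<^bsub>G\<^esub> t"
    using N3[of q s] \<open>q \<rightarrow>\<^bsub>G\<^esub> p\<close> \<open>q \<rightarrow>\<^bsub>G\<^esub> r\<close> \<open>s \<rightarrow>\<^bsub>G\<^esub> r\<close> \<open>s \<rightarrow>\<^bsub>G\<^esub> t\<close> by (metis adj_in_verts)
  then show False
    using chordless by blast
qed

lemma no_induced_hexagon:
  assumes "p \<rightarrow>\<^bsub>G\<^esub> q \<or> q \<rightarrow>\<^bsub>G\<^esub> p" "q \<rightarrow>\<^bsub>G\<^esub> r \<or> r \<rightarrow>\<^bsub>G\<^esub> q" "r \<rightarrow>\<^bsub>G\<^esub> s \<or> s \<rightarrow>\<^bsub>G\<^esub> r"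
      "s \<rightarrow>\<^bsub>G\<^esub> t \<or> t \<rightarrow>\<^bsub>G\<^esub> s" "t \<rightarrow>\<^bsub>G\<^esub> u \<or> u \<rightarrow>\<^bsub>G\<^esub> t" "u \<rightarrow>\<^bsub>G\<^esub> p \<or> p \<rightarrow>\<^bsub>G\<^esub> u"
    and "distinct [p, q, r, s, t, u]"
    and "\<not> p \<rightarrow>\<^bsub>G\<^esub> s" "\<not> s \<rightarrow>\<^bsub>G\<^esub> p" "\<not> q \<rightarrow>\<^bsub>G\<^esub> t" "\<not> t \<rightarrow>\<^bsub>G\<^esub> q" "\<not> r \<rightarrow>\<^bsub>G\<^esub> u" "\<not> u \<rightarrow>\<^bsub>G\<^esub> r"
  shows False
proof -
  have "\<not> q \<rightarrow>\<^bsub>G\<^esub> p"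
    using assms(2-13) by (rule no_induced_hexagon_oriented)
  moreover have "distinct [q, p, u, t, s, r]"
    using assms(7) by auto
  then have "\<not> p \<rightarrow>\<^bsub>G\<^esub> q"
    \<comment> \<open>The reflection swaps \<open>p\<close> with \<open>q\<close>, \<open>r\<close>
      with \<open>u\<close> and \<open>s\<close> with \<open>t\<close>. Rotating the distinctness
      premise to the front lets the chained fact fix all six variables.\<close>
    by (rule no_induced_hexagon_oriented[rotated 5]) (use assms in blast)+
  ultimately show False
    using assms(1) by blast
qed

end

lemma C6_adj:
  "u \<rightarrow>\<^bsub>C6\<^esub> v \<longleftrightarrow>
    (u, v) \<in> {(1,2), (2,1), (2,3), (3,2), (3,4), (4,3), (4,5), (5,4), (5,6), (6,5), (6,1), (1,6)}"
proof -
  have *: "{1..5} = {1, 2, 3, 4, 5 :: nat}"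
    by auto
  show ?thesis
    \<comment> \<open>In successor form the unrolled arcs \<open>(i, i + 1)\<close> and the listed
      numerals become the same terms.\<close>
    unfolding C6_def with_proj_simps pair_pre_digraph.simps * by (simp add: numeral_eq_Suc disj_ac)
qed

theorem theorem3p9:
  fixes G :: "('a, 'b) pre_digraph"
  assumes "two_qBMG G"
  shows "C6_free (underlying_graph G)"
proof -
  interpret two_qBMG G by fact
  have False if H: "induced_subgraph H (underlying_graph G)" "digraph_iso H C6" for H
  proof -
    \<comment> \<open>Well-formedness allows the isomorphism to be reversed, so that
      \<open>f\<close> labels the vertices of \<open>H\<close> by 1 to 6.\<close>
    have "wf_digraph H"
      using H(2) by (auto simp: digraph_iso_def pre_digraph.digraph_isomorphism_def)
    then have "digraph_iso C6 H"
      using H(2) by (rule digraph_iso_swap)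
    then obtain f where bij: "bij_betw f (verts C6) (verts H)"
      and iso: "\<And>i j. \<lbrakk>i \<in> verts C6; j \<in> verts C6\<rbrakk> \<Longrightarrow> f i \<rightarrow>\<^bsub>H\<^esub> f j \<longleftrightarrow> i \<rightarrow>\<^bsub>C6\<^esub> j"
      by (rule digraph_isoE) blast
    have V: "verts C6 = {1..6}" by (simp add: C6_def)
    have adj: "f i \<rightarrow>\<^bsub>G\<^esub> f j \<or> f j \<rightarrow>\<^bsub>G\<^esub> f i \<longleftrightarrow> i \<rightarrow>\<^bsub>C6\<^esub> j" if "i \<in> {1..6}" "j \<in> {1..6}" for i j
      using that iso[of i j] induced_subgraph_adj[OF H(1), of "f i" "f j"] bij
      by (auto simp: V underlying_graph_adj dest: bij_betwE)
    have inj: "f i = f j \<longleftrightarrow> i = j" if "i \<in> {1..6}" "j \<in> {1..6}" for i j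
      using that bij by (auto simp: V bij_betw_def dest: inj_onD)
    show False
      \<comment> \<open>The nine instances of \<open>adj\<close> are the six sides and the three
        long diagonals.\<close>
      by (rule no_induced_hexagon[of "f 1" "f 2" "f 3" "f 4" "f 5" "f 6"])
        (use adj[of 1 2] adj[of 2 3] adj[of 3 4] adj[of 4 5] adj[of 5 6] adj[of 6 1]
          adj[of 1 4] adj[of 2 5] adj[of 3 6] in \<open>simp_all add: C6_adj inj\<close>)
  qed
  then show ?thesis
    by (auto simp: C6_free_def)
qed

end
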